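(* Let $A\in\mathbb{R}^{m\times n}$, $1\le k<\min(m,n)$, and let $\widehat V_k\in\mathbb{R}^{m\times k}$, $\widehat S_k\in\mathbb{R}^{k\times k}$, $\widehat W_k\in\mathbb{R}^{n\times k}$ satisfy $$\|A-\widehat V_k\widehat S_k\widehat W_k^T\|\le \theta\,\sigma_{k+1}+\phi$$ for some real quantities $\theta,\phi$. Let $p\in\{1,\dots,m\}^k$ and $q\in\{1,\dots,n\}^k$ be index vectors, $P=I(:,p)\in\mathbb{R}^{m\times k}$, $Q=I(:,q)\in\mathbb{R}^{n\times k}$, and assume that $P^T\widehat V_k$ and $\widehat W_k^TQ$ are invertible. Set $\tilde\eta_p=\|(P^T\widehat V_k)^{-1}\|$ and $\tilde\eta_q=\|(\widehat W_k^TQ)^{-1}\|$. Then for $C=AQ$ and $R=P^TA$, $$\|(I-CC^\dagger)A\|\le \|\widehat W_k\|\,\tilde\eta_q\,(\theta\,\sigma_{k+1}+\phi),$$ $$\|A(I-R^\dagger R)\|\le \|\widehat V_k\|\,\tilde\eta_p\,(\theta\,\sigma_{k+1}+\phi).$$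
   Context: $\|\cdot\|$ denotes the matrix 2-norm (spectral norm). $\sigma_{k+1}$ is the $(k+1)$-th singular value of $A$ in descending order. $\dagger$ denotes the Moore–Penrose pseudoinverse. The columns of $\widehat V_k$ and $\widehat W_k$ are not assumed orthonormal and $\widehat S_k$ need not contain exact singular values of $A$. $I(:,p)$ (resp. $I(:,q)$) is the matrix whose $j$-th column is the $p_j$-th (resp. $q_j$-th) column of the identity matrix of size $m$ (resp. $n$). *)

theory Defs
  imports "HOL-Analysis.Analysis" "HOL-Computational_Algebra.Polynomial"
begin

definition spectral_norm :: "real ^ 'n ^ 'm \<Rightarrow> real" where
  "spectral_norm A = onorm (\<lambda>x. A *v x)"

definition charpoly :: "real ^ 'n ^ 'n \<Rightarrow> real poly" where
  "charpoly M = det (mat [:0, 1:] - map_matrix (\<lambda>a. [:a:]) M)"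

(* The square roots of the n eigenvalues of A^T A, counted with multiplicity, in descending
   order; A has min(m,n) singular values, and the entries dropped by take when m < n are
   zeros. The characteristic polynomial of the symmetric matrix A^T A splits over the reals,
   so proots lists all n eigenvalues. *)
definition singular_values :: "real ^ 'n ^ 'm \<Rightarrow> real list" where
  "singular_values A =
     take (min CARD('m) CARD('n))
       (rev (sorted_list_of_multiset (image_mset sqrt (proots (charpoly (transpose A ** A))))))"

(* Singular values are numbered from 1, list positions from 0. *)
definition singular_value :: "real ^ 'n ^ 'm \<Rightarrow> nat \<Rightarrow> real" where
  "singular_value A j = singular_values A ! (j - 1)"

(* The four Penrose conditions, which determine X uniquely. *)
definition is_pinv :: "real ^ 'n ^ 'm \<Rightarrow> real ^ 'm ^ 'n \<Rightarrow> bool" where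
  "is_pinv A X \<longleftrightarrow>
     A ** X ** A = A \<and> X ** A ** X = X \<and>
     transpose (A ** X) = A ** X \<and> transpose (X ** A) = X ** A"

definition pinv :: "real ^ 'n ^ 'm \<Rightarrow> real ^ 'm ^ 'n" where
  "pinv A = (THE X. is_pinv A X)"

(* I(:,p): the j-th column is the (p j)-th column of the identity. *)
definition identity_columns :: "('k \<Rightarrow> 'm) \<Rightarrow> real ^ 'k ^ 'm" where
  "identity_columns p = (\<chi> i j. column (p j) (mat 1 :: real ^ 'm ^ 'm) $ i)"

end

theory Submission
  imports Defs
begin

text \<open>
  The error of a projection onto the column space of \<open>C = A Q\<close> is controlled by an
  \<^emph>\<open>oblique\<close> projector that is adapted to the approximate factor \<open>W\<close>. Put
  \<open>Z = Q (W\<^sup>T Q)\<^sup>-\<^sup>1 W\<^sup>T\<close>. Then \<open>W\<^sup>T (I - Z) = 0\<close>, so that \<open>A (I - Z) = E (I - Z)\<close> for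
  \<open>E = A - V S W\<^sup>T\<close>; and \<open>A Z\<close> has the form \<open>C X\<close>, so that the orthogonal projector
  \<open>I - C C\<^sup>\<dagger>\<close> annihilates it. Hence
  \<open>(I - C C\<^sup>\<dagger>) A = (I - C C\<^sup>\<dagger>) E (I - Z)\<close>, and so
  \<open>\<parallel>(I - C C\<^sup>\<dagger>) A\<parallel> \<le> \<parallel>E\<parallel> \<parallel>I - Z\<parallel>\<close>.
  The estimate \<open>\<parallel>I - Z\<parallel> \<le> 1 + \<parallel>Z\<parallel>\<close> would be too weak. The sharp bound rests on the fact that
  \<open>\<parallel>I - Z\<parallel> \<le> \<parallel>Z\<parallel>\<close> for every nonzero idempotent \<open>Z\<close> of a Euclidean space
  (\<open>spectral_norm_complementary_projector_le\<close>). Finally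
  \<open>\<parallel>Z\<parallel> \<le> \<parallel>Q\<parallel> \<parallel>(W\<^sup>T Q)\<^sup>-\<^sup>1\<parallel> \<parallel>W\<parallel>\<close>, and \<open>\<parallel>Q\<parallel> \<le> 1\<close> because the invertibility of
  \<open>W\<^sup>T Q\<close> forces the selected columns of the identity to be distinct.

  The bound for the rows is the mirror image: \<open>Z = V (P\<^sup>T V)\<^sup>-\<^sup>1 P\<^sup>T\<close> acts from the left, and
  \<open>I - R\<^sup>\<dagger> R\<close> annihilates \<open>X R\<close> from the right.

  That \<open>C C\<^sup>\<dagger>\<close> and \<open>R\<^sup>\<dagger> R\<close> are orthogonal projectors follows from the Penrose conditions. These
  have exactly one solution (\<open>is_pinv_pinv\<close>), which is built from solutions of the normal equations.
\<close>

section \<open>Matrix algebra\<close>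

lemma matrix_mult_diff_left:
  fixes A :: "real ^ 'n ^ 'm" and B D :: "real ^ 'k ^ 'n"
  shows "A ** (B - D) = A ** B - A ** D"
  by (simp add: vec_eq_iff matrix_matrix_mult_def right_diff_distrib sum_subtractf)

lemma matrix_mult_diff_right:
  fixes A B :: "real ^ 'n ^ 'm" and D :: "real ^ 'k ^ 'n"
  shows "(A - B) ** D = A ** D - B ** D"
  by (simp add: vec_eq_iff matrix_matrix_mult_def left_diff_distrib sum_subtractf)

lemma transpose_diff:
  fixes A B :: "real ^ 'n ^ 'm"
  shows "transpose (A - B) = transpose A - transpose B"
  by (simp add: vec_eq_iff transpose_def)

lemma matrix_mult_zero_left [simp]: "(0 :: real ^ 'n ^ 'm) ** (B :: real ^ 'k ^ 'n) = 0"
  by (simp add: vec_eq_iff matrix_matrix_mult_def)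

lemma matrix_mult_zero_right [simp]: "(A :: real ^ 'n ^ 'm) ** (0 :: real ^ 'k ^ 'n) = 0"
  by (simp add: vec_eq_iff matrix_matrix_mult_def)

lemma
  fixes M :: "real ^ 'k ^ 'k"
  assumes "invertible M"
  shows matrix_inv_right_cancel: "M ** matrix_inv M = mat 1"
    and matrix_inv_left_cancel: "matrix_inv M ** M = mat 1"
proof -
  have "M ** matrix_inv M = mat 1 \<and> matrix_inv M ** M = mat 1"
    using assms unfolding matrix_inv_def invertible_def by (rule someI_ex)
  then show "M ** matrix_inv M = mat 1" "matrix_inv M ** M = mat 1" by auto
qed

lemma inner_transpose_vec:
  fixes A :: "real ^ 'n ^ 'm"
  shows "(transpose A *v x) \<bullet> y = x \<bullet> (A *v y)"
  by (simp add: dot_lmul_matrix)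

lemma mat_1_neq_0: "(mat 1 :: real ^ 'k ^ 'k) \<noteq> 0"
  by (simp add: vec_eq_iff mat_def)

text \<open>
  Allows a factor \<open>A\<^sup>T A\<close> to be replaced by \<open>A\<close> in identities, since
  \<open>\<parallel>D x\<parallel>\<^sup>2 = x\<^sup>T D\<^sup>T D x\<close>.
\<close>
lemma transpose_mult_self_eq_0D:
  fixes D :: "real ^ 'n ^ 'm"
  assumes "transpose D ** D = 0"
  shows "D = 0"
proof -
  have "D *v x = 0" for x
  proof -
    have "(D *v x) \<bullet> (D *v x) = (transpose D *v (D *v x)) \<bullet> x"
      by (simp only: inner_transpose_vec)
    also have "\<dots> = 0"
      using assms by (simp only: matrix_vector_mul_assoc) simp
    finally show ?thesis by simp
  qed
  then show ?thesis
    by (simp add: matrix_eq)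
qed

section \<open>Existence and uniqueness of the pseudoinverse\<close>

text \<open>
  The orthogonal projection of \<open>b\<close> onto the range of \<open>A\<close> is some \<open>A z\<close>, and \<open>A\<^sup>T\<close> annihilates
  the residual.
\<close>
lemma normal_equations_solvable:
  fixes A :: "real ^ 'n ^ 'm"
  shows "\<exists>z. transpose A *v (A *v z) = transpose A *v b"
proof -
  obtain y w where y: "y \<in> span (range ((*v) A))"
    and w: "\<And>u. u \<in> span (range ((*v) A)) \<Longrightarrow> orthogonal w u" and b: "b = y + w"
    using orthogonal_subspace_decomp_exists[of "range ((*v) A)" b] by blast
  have "subspace (range ((*v) A))"
    by (simp add: linear_subspace_image)
  with y obtain z where z: "y = A *v z"
    by (auto simp: span_eq_iff[THEN iffD2])
  have "(transpose A *v w) \<bullet> x = 0" for x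
    using w[of "A *v x"] unfolding inner_transpose_vec
    by (simp add: orthogonal_def span_base)
  then have "transpose A *v w = 0"
    using inner_eq_zero_iff by blast
  then have "transpose A *v b = transpose A *v y"
    by (simp only: b matrix_vector_right_distrib) simp
  with z show ?thesis by metis
qed

lemma normal_equations_solvable_matrix:
  fixes A :: "real ^ 'n ^ 'm"
  shows "\<exists>G. transpose A ** (A ** G) = transpose A"
proof -
  obtain z where z: "\<And>b. transpose A *v (A *v z b) = transpose A *v b"
    using normal_equations_solvable[of A] by metis
  define G :: "real ^ 'm ^ 'n" where "G = (\<chi> i j. z (axis j 1) $ i)"
  have "(transpose A ** (A ** G)) *v axis j 1 = transpose A *v axis j 1" for j
  proof -
    have "G *v axis j 1 = z (axis j 1)"
      by (simp add: matrix_vector_mult_basis G_def column_def vec_eq_iff)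
    then show ?thesis
      using z[of "axis j 1"] by (simp only: matrix_vector_mul_assoc[symmetric])
  qed
  then have "column j (transpose A ** (A ** G)) = column j (transpose A)" for j
    by (simp only: matrix_vector_mult_basis)
  then have "transpose A ** (A ** G) = transpose A"
    by (simp add: column_def vec_eq_iff)
  then show ?thesis ..
qed

text \<open>
  Least squares provides half of the Penrose conditions: the first and the third.
\<close>
lemma least_squares_inverse_exists:
  fixes A :: "real ^ 'n ^ 'm"
  shows "\<exists>G. A ** G ** A = A \<and> transpose (A ** G) = A ** G"
proof -
  obtain G where G: "transpose A ** (A ** G) = transpose A"
    using normal_equations_solvable_matrix by blast
  have "transpose (A ** G) ** (A ** G) = transpose G ** (transpose A ** (A ** G))"
    by (simp add: matrix_transpose_mul matrix_mul_assoc)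
  also have "\<dots> = transpose (A ** G)"
    by (simp add: G matrix_transpose_mul)
  finally have eq: "transpose (A ** G) ** (A ** G) = transpose (A ** G)" .
  \<comment> \<open>The left-hand side is symmetric, hence so is \<open>A G\<close>.\<close>
  have sym: "transpose (A ** G) = A ** G"
    by (metis eq matrix_transpose_mul transpose_transpose)
  define D where "D = A ** G ** A - A"
  have "transpose A ** D = 0"
    using G by (simp add: D_def matrix_mult_diff_left matrix_mul_assoc)
  moreover have "transpose D = (transpose (G ** A) - mat 1) ** transpose A"
    by (simp add: D_def transpose_diff matrix_transpose_mul matrix_mult_diff_right matrix_mul_assoc)
  ultimately have "transpose D ** D = 0"
    by (simp add: matrix_mul_assoc[symmetric])
  then have "D = 0" by (rule transpose_mult_self_eq_0D)
  with sym show ?thesis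
    by (auto simp: D_def)
qed

text \<open>
  If \<open>G\<close> makes \<open>A G\<close> and \<open>K\<close> makes \<open>K A\<close> the orthogonal projector required by the Penrose
  conditions, then \<open>K A G\<close> does both; such a \<open>K\<close> is the transpose of a least-squares inverse
  of \<open>A\<^sup>T\<close>.
\<close>
lemma is_pinv_exists:
  fixes A :: "real ^ 'n ^ 'm"
  shows "\<exists>X. is_pinv A X"
proof -
  obtain G where G: "A ** G ** A = A" "transpose (A ** G) = A ** G"
    using least_squares_inverse_exists by blast
  obtain H where H: "transpose A ** H ** transpose A = transpose A"
      "transpose (transpose A ** H) = transpose A ** H"
    using least_squares_inverse_exists[of "transpose A"] by blast
  define K where "K = transpose H"
  have K: "A ** K ** A = A"
    using arg_cong[OF H(1), of transpose]
    by (simp add: matrix_transpose_mul K_def matrix_mul_assoc)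
  have Ksym: "transpose (K ** A) = K ** A"
    using H(2) by (simp add: matrix_transpose_mul K_def)
  define X where "X = K ** A ** G"
  have AX: "A ** X = A ** G"
    by (simp add: X_def matrix_mul_assoc K)
  have XA: "X ** A = K ** A"
    using arg_cong[OF G(1), of "(**) K"] by (simp add: X_def matrix_mul_assoc)
  have "X ** A ** X = K ** (A ** X)"
    by (simp only: XA matrix_mul_assoc[symmetric])
  also have "\<dots> = X"
    by (simp only: AX) (simp add: X_def matrix_mul_assoc)
  finally have "is_pinv A X"
    by (simp add: is_pinv_def AX XA G Ksym)
  then show ?thesis ..
qed

text \<open>
  The argument is that both \<open>A X\<close> and \<open>A Y\<close> are the orthogonal projector onto the range of \<open>A\<close>, and both \<open>X A\<close> and
  \<open>Y A\<close> the one onto the range of \<open>A\<^sup>T\<close>.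
\<close>
lemma is_pinv_unique:
  fixes A :: "real ^ 'n ^ 'm"
  assumes X: "is_pinv A X" and Y: "is_pinv A Y"
  shows "X = Y"
proof -
  have "A ** X = transpose ((A ** X) ** (A ** Y))"
  proof -
    have "A ** X = (A ** Y) ** (A ** X)"
      using Y by (simp add: is_pinv_def matrix_mul_assoc)
    then show ?thesis
      using X Y by (simp add: is_pinv_def matrix_transpose_mul[of "A ** X"])
  qed
  also have "\<dots> = A ** Y"
    using X Y by (simp add: is_pinv_def matrix_mul_assoc)
  finally have AX: "A ** X = A ** Y" .
  have "X ** A = transpose ((Y ** A) ** (X ** A))"
  proof -
    have "X ** A = (X ** A) ** (Y ** A)"
      using Y by (metis is_pinv_def matrix_mul_assoc)
    then show ?thesis
      using X Y by (simp add: is_pinv_def matrix_transpose_mul[of "Y ** A"])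
  qed
  also have "\<dots> = Y ** A"
    using X Y by (metis is_pinv_def matrix_mul_assoc)
  finally have XA: "X ** A = Y ** A" .
  have "X = X ** (A ** X)"
    using X by (simp add: is_pinv_def matrix_mul_assoc)
  also have "\<dots> = Y ** A ** Y"
    by (simp add: AX matrix_mul_assoc XA)
  also have "\<dots> = Y"
    using Y by (simp add: is_pinv_def)
  finally show ?thesis .
qed

lemma is_pinv_pinv: "is_pinv A (pinv A)"
  unfolding pinv_def by (rule theI') (use is_pinv_exists is_pinv_unique in blast)

section \<open>The spectral norm\<close>

lemma norm_mult_le_spectral_norm: "norm (A *v x) \<le> spectral_norm A * norm x"
  unfolding spectral_norm_def by (rule onorm) simp

lemma spectral_norm_leI:
  assumes "\<And>x. norm (A *v x) \<le> b * norm x"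
  shows "spectral_norm A \<le> b"
  unfolding spectral_norm_def using assms by (rule onorm_le)

lemma spectral_norm_nonneg: "0 \<le> spectral_norm A"
  unfolding spectral_norm_def by (rule onorm_pos_le) simp

lemma spectral_norm_mult_le:
  fixes A :: "real ^ 'n ^ 'm" and B :: "real ^ 'k ^ 'n"
  shows "spectral_norm (A ** B) \<le> spectral_norm A * spectral_norm B"
proof -
  have "(*v) (A ** B) = (*v) A \<circ> (*v) B"
    by (simp add: fun_eq_iff matrix_vector_mul_assoc)
  then show ?thesis
    unfolding spectral_norm_def by (simp only: onorm_compose matrix_vector_mul_bounded_linear)
qed

text \<open>Cauchy--Schwarz applied to \<open>\<parallel>A\<^sup>T x\<parallel>\<^sup>2 = x\<^sup>T (A (A\<^sup>T x))\<close>.\<close>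
lemma spectral_norm_transpose_le:
  fixes A :: "real ^ 'n ^ 'm"
  shows "spectral_norm (transpose A) \<le> spectral_norm A"
proof (rule spectral_norm_leI)
  fix x
  define y where "y = transpose A *v x"
  have "norm y * norm y = y \<bullet> y"
    by (simp flip: power2_eq_square add: power2_norm_eq_inner)
  also have "\<dots> = x \<bullet> (A *v y)"
    using inner_transpose_vec[of A x y] by (simp only: y_def)
  also have "\<dots> \<le> norm x * (spectral_norm A * norm y)"
    by (rule order_trans[OF norm_cauchy_schwarz mult_left_mono[OF norm_mult_le_spectral_norm]]) simp
  finally have "norm y * norm y \<le> (spectral_norm A * norm x) * norm y"
    by (simp add: ac_simps)
  then have "norm y \<le> spectral_norm A * norm x"
    by (cases "y = 0") (simp_all add: spectral_norm_nonneg)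
  then show "norm (transpose A *v x) \<le> spectral_norm A * norm x"
    unfolding y_def .
qed

text \<open>\<open>\<parallel>E x\<parallel>\<^sup>2 = x\<^sup>T E x \<le> \<parallel>x\<parallel> \<parallel>E x\<parallel>\<close>.\<close>
lemma spectral_norm_orthogonal_projector_le_1:
  fixes E :: "real ^ 'n ^ 'n"
  assumes sym: "transpose E = E" and idem: "E ** E = E"
  shows "spectral_norm E \<le> 1"
proof (rule spectral_norm_leI)
  fix x
  have "norm (E *v x) * norm (E *v x) = (transpose E *v x) \<bullet> (E *v x)"
    by (simp only: sym) (simp add: norm_eq_sqrt_inner)
  also have "\<dots> = x \<bullet> (E *v x)"
    by (simp only: inner_transpose_vec matrix_vector_mul_assoc idem)
  also have "\<dots> \<le> norm x * norm (E *v x)"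
    by (rule norm_cauchy_schwarz)
  finally show "norm (E *v x) \<le> 1 * norm x"
    by (cases "E *v x = 0") simp_all
qed

text \<open>
  Split \<open>x = u + v\<close> with \<open>u = Z x\<close>. Exchanging the lengths of \<open>u\<close> and \<open>v\<close> while keeping their
  directions gives a vector \<open>w\<close> with \<open>\<parallel>w\<parallel> = \<parallel>x\<parallel>\<close> and
  \<open>\<parallel>Z w\<parallel> = \<parallel>v\<parallel> = \<parallel>(I - Z) x\<parallel>\<close>. When \<open>u = 0\<close> there is no direction to rescale; then
  \<open>\<parallel>Z\<parallel> \<ge> 1\<close> is used, which holds as \<open>Z\<close> fixes a nonzero vector.
\<close>
lemma spectral_norm_complementary_projector_le:
  fixes Z :: "real ^ 'n ^ 'n"
  assumes idem: "Z ** Z = Z" and nz: "Z \<noteq> 0"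
  shows "spectral_norm (mat 1 - Z) \<le> spectral_norm Z"
proof (rule spectral_norm_leI)
  fix x
  define u v where "u = Z *v x" and "v = (mat 1 - Z) *v x"
  have x: "x = u + v"
    by (simp add: u_def v_def matrix_vector_mult_diff_rdistrib)
  have Zu: "Z *v u = u"
    by (simp add: u_def matrix_vector_mul_assoc idem)
  have Zv: "Z *v v = 0"
    using Zu by (simp add: v_def matrix_vector_mult_diff_rdistrib matrix_vector_mult_diff_distrib u_def)
  have "norm v \<le> spectral_norm Z * norm x"
  proof (cases "v = 0")
    case True
    then show ?thesis by (simp add: spectral_norm_nonneg)
  next
    case v: False
    show ?thesis
    proof (cases "u = 0")
      case True
      obtain y where y: "Z *v y \<noteq> 0"
        using nz by (auto simp: matrix_eq)
      have "norm (Z *v y) = norm (Z *v (Z *v y))"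
        by (simp only: matrix_vector_mul_assoc idem)
      also have "\<dots> \<le> spectral_norm Z * norm (Z *v y)"
        by (rule norm_mult_le_spectral_norm)
      finally have "1 \<le> spectral_norm Z"
        using y by simp
      then have "1 * norm x \<le> spectral_norm Z * norm x"
        by (rule mult_right_mono) simp
      with True x show ?thesis by simp
    next
      case u: False
      define c where "c = norm v / norm u"
      define w where "w = c *\<^sub>R u + inverse c *\<^sub>R v"
      have c: "c > 0" using u v by (simp add: c_def)
      have cu: "norm (c *\<^sub>R u) = norm v" and cv: "norm (inverse c *\<^sub>R v) = norm u"
        using u v by (simp_all add: c_def)
      have "(norm w)\<^sup>2 = (norm (c *\<^sub>R u))\<^sup>2 + (norm (inverse c *\<^sub>R v))\<^sup>2
          + 2 * ((c *\<^sub>R u) \<bullet> (inverse c *\<^sub>R v))"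
        unfolding w_def power2_norm_eq_inner
        by (simp only: inner_add_left inner_add_right) (simp add: inner_commute)
      also have "\<dots> = (norm v)\<^sup>2 + (norm u)\<^sup>2 + 2 * (u \<bullet> v)"
        unfolding cu cv using c by simp
      also have "\<dots> = (norm x)\<^sup>2"
        unfolding x power2_norm_eq_inner
        by (simp add: inner_add_left inner_add_right inner_commute)
      finally have w: "norm w = norm x" by simp
      have "Z *v w = c *\<^sub>R u"
        by (simp add: w_def matrix_vector_right_distrib matrix_vector_mult_scaleR Zu Zv)
      with cu have "norm v = norm (Z *v w)" by simp
      also have "\<dots> \<le> spectral_norm Z * norm w"
        by (rule norm_mult_le_spectral_norm)
      finally show ?thesis by (simp only: w)
    qed
  qed
  then show "norm ((mat 1 - Z) *v x) \<le> spectral_norm Z * norm x"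
    by (simp only: v_def)
qed

section \<open>Oblique and orthogonal projectors in the error bound\<close>

text \<open>
  \<open>Z\<close> is the projector onto the column space of \<open>N\<close> along the kernel of \<open>M\<close>; it is nonzero since \<open>M Z = M\<close>
  and \<open>M \<noteq> 0\<close>, so that the bound on complementary projectors applies.
\<close>
lemma oblique_projector:
  fixes M :: "real ^ 'n ^ 'k" and N :: "real ^ 'k ^ 'n"
  assumes inv: "invertible (M ** N)"
  defines "Z \<equiv> N ** matrix_inv (M ** N) ** M"
  shows "M ** (mat 1 - Z) = 0" and "(mat 1 - Z) ** N = 0"
    and "spectral_norm (mat 1 - Z)
           \<le> spectral_norm N * spectral_norm (matrix_inv (M ** N)) * spectral_norm M"
proof -
  let ?J = "matrix_inv (M ** N)"
  have MZ: "M ** Z = M"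
    using matrix_inv_right_cancel[OF inv] by (simp add: Z_def matrix_mul_assoc)
  have "Z ** N = N ** (?J ** (M ** N))"
    by (simp add: Z_def matrix_mul_assoc)
  then have ZN: "Z ** N = N"
    using matrix_inv_left_cancel[OF inv] by simp
  show "M ** (mat 1 - Z) = 0" "(mat 1 - Z) ** N = 0"
    by (simp_all add: matrix_mult_diff_left matrix_mult_diff_right MZ ZN)
  have idem: "Z ** Z = Z"
    by (metis MZ Z_def matrix_mul_assoc)
  have "Z \<noteq> 0"
  proof
    assume "Z = 0"
    with MZ have "M = 0" by simp
    with matrix_inv_right_cancel[OF inv] show False by (simp add: mat_1_neq_0)
  qed
  then have "spectral_norm (mat 1 - Z) \<le> spectral_norm Z"
    by (rule spectral_norm_complementary_projector_le[OF idem])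
  also have "\<dots> \<le> spectral_norm (N ** ?J) * spectral_norm M"
    unfolding Z_def by (rule spectral_norm_mult_le)
  also have "\<dots> \<le> spectral_norm N * spectral_norm ?J * spectral_norm M"
    by (rule mult_right_mono[OF spectral_norm_mult_le spectral_norm_nonneg])
  finally show "spectral_norm (mat 1 - Z)
           \<le> spectral_norm N * spectral_norm ?J * spectral_norm M" .
qed

lemma residual_projector_pinv:
  fixes C :: "real ^ 'k ^ 'm"
  shows "(mat 1 - C ** pinv C) ** C = 0" and "C ** (mat 1 - pinv C ** C) = 0"
    and "spectral_norm (mat 1 - C ** pinv C) \<le> 1"
    and "spectral_norm (mat 1 - pinv C ** C) \<le> 1"
proof -
  let ?X = "pinv C"
  have X: "C ** ?X ** C = C" "?X ** C ** ?X = ?X"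
      "transpose (C ** ?X) = C ** ?X" "transpose (?X ** C) = ?X ** C"
    using is_pinv_pinv[of C] by (auto simp: is_pinv_def)
  show "(mat 1 - C ** ?X) ** C = 0" "C ** (mat 1 - ?X ** C) = 0"
    by (simp_all add: matrix_mult_diff_left matrix_mult_diff_right matrix_mul_assoc X)
  show "spectral_norm (mat 1 - C ** ?X) \<le> 1"
    by (rule spectral_norm_orthogonal_projector_le_1)
      (simp_all add: transpose_diff matrix_mult_diff_left matrix_mult_diff_right matrix_mul_assoc X)
  show "spectral_norm (mat 1 - ?X ** C) \<le> 1"
    by (rule spectral_norm_orthogonal_projector_le_1)
      (simp_all add: transpose_diff matrix_mult_diff_left matrix_mult_diff_right matrix_mul_assoc X)
qed

section \<open>Column selection\<close>

text \<open>
  A repeated index gives \<open>I(:,q)\<close> two equal columns, hence a nontrivial kernel, which every product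
  \<open>M I(:,q)\<close> inherits.
\<close>
lemma inj_if_invertible_identity_columns:
  fixes M :: "real ^ 'n ^ 'k" and q :: "'k \<Rightarrow> 'n"
  assumes inv: "invertible (M ** identity_columns q)"
  shows "inj q"
proof (rule injI)
  fix i j
  assume eq: "q i = q j"
  have "identity_columns q *v axis i 1 = (identity_columns q *v axis j 1 :: real ^ 'n)"
    by (simp add: matrix_vector_mult_basis vec_eq_iff column_def identity_columns_def eq)
  then have "(M ** identity_columns q) *v axis i 1 = (M ** identity_columns q) *v axis j 1"
    by (simp only: matrix_vector_mul_assoc[symmetric])
  then have "axis i 1 = (axis j 1 :: real ^ 'k)"
    using matrix_inv_left_cancel[OF inv] by (metis matrix_vector_mul_assoc matrix_vector_mul_lid)
  then show "i = j" by (simp add: axis_eq_axis)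
qed

text \<open>Distinct columns of the identity are orthonormal, so that \<open>I(:,q)\<close> is an isometry.\<close>
lemma spectral_norm_identity_columns_le_1:
  fixes q :: "'k::finite \<Rightarrow> 'n::finite"
  assumes "inj q"
  shows "spectral_norm (identity_columns q) \<le> 1"
proof (rule spectral_norm_leI)
  fix x :: "real ^ 'k"
  let ?Q = "identity_columns q"
  have "(transpose ?Q ** ?Q) $ i $ j = (mat 1 :: real ^ 'k ^ 'k) $ i $ j" for i j
  proof -
    have "(transpose ?Q ** ?Q) $ i $ j
        = (\<Sum>l\<in>UNIV. (if l = q i then 1 else 0) * (if l = q j then 1 else (0 :: real)))"
      by (simp add: matrix_matrix_mult_def transpose_def identity_columns_def column_def mat_def)
    also have "\<dots> = (\<Sum>l\<in>UNIV. if l = q i then (if q i = q j then 1 else 0) else 0)"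
      by (intro sum.cong) auto
    also have "\<dots> = (if q i = q j then 1 else 0)"
      by simp
    finally show ?thesis
      using assms by (simp add: mat_def inj_eq)
  qed
  then have QQ: "transpose ?Q ** ?Q = mat 1"
    by (simp add: vec_eq_iff)
  have "(?Q *v x) \<bullet> (?Q *v x) = (transpose ?Q *v (?Q *v x)) \<bullet> x"
    by (simp only: inner_transpose_vec)
  also have "\<dots> = x \<bullet> x"
    by (simp only: matrix_vector_mul_assoc QQ matrix_vector_mul_lid)
  finally show "norm (?Q *v x) \<le> 1 * norm x"
    by (simp add: norm_eq_sqrt_inner)
qed

section \<open>The column and row interpolation bounds\<close>

text \<open>
  With \<open>Z\<close> the oblique projector along the kernel of \<open>W\<^sup>T\<close>, the factor \<open>I - Z\<close> removes
  \<open>B W\<^sup>T\<close>, while the columns of \<open>A Z\<close> lie in the column space of \<open>A Q\<close>, which the residual projector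
  on the left annihilates.
\<close>
lemma column_projection_error:
  fixes A :: "real ^ 'n ^ 'm" and B :: "real ^ 'k ^ 'm" and W Q :: "real ^ 'k ^ 'n"
  assumes inv: "invertible (transpose W ** Q)"
    and err: "spectral_norm (A - B ** transpose W) \<le> e"
    and Q: "spectral_norm Q \<le> 1"
  shows "spectral_norm ((mat 1 - (A ** Q) ** pinv (A ** Q)) ** A)
           \<le> spectral_norm W * spectral_norm (matrix_inv (transpose W ** Q)) * e"
proof -
  let ?J = "matrix_inv (transpose W ** Q)"
  define Z where "Z = Q ** ?J ** transpose W"
  define E where "E = A - B ** transpose W"
  define D where "D = mat 1 - (A ** Q) ** pinv (A ** Q)"
  note obl = oblique_projector[OF inv, folded Z_def]
  have "B ** transpose W ** (mat 1 - Z) = 0"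
    using obl(1) by (simp add: matrix_mul_assoc[symmetric])
  then have E: "E ** (mat 1 - Z) = A ** (mat 1 - Z)"
    by (simp add: E_def matrix_mult_diff_right)
  have "D ** (A ** Z) = (D ** (A ** Q)) ** (?J ** transpose W)"
    by (simp add: Z_def matrix_mul_assoc)
  also have "\<dots> = 0"
    by (simp add: D_def residual_projector_pinv(1))
  finally have "D ** A = D ** (A ** (mat 1 - Z))"
    by (simp add: matrix_mult_diff_left)
  then have DA: "D ** A = D ** (E ** (mat 1 - Z))"
    by (simp only: E)
  have e: "0 \<le> e" using spectral_norm_nonneg err by (rule order_trans)
  have "spectral_norm (mat 1 - Z) \<le> spectral_norm Q * spectral_norm ?J * spectral_norm (transpose W)"
    by (rule obl(3))
  also have "\<dots> \<le> 1 * spectral_norm ?J * spectral_norm W"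
    by (intro mult_mono Q spectral_norm_transpose_le mult_nonneg_nonneg spectral_norm_nonneg) simp_all
  finally have Z: "spectral_norm (mat 1 - Z) \<le> spectral_norm W * spectral_norm ?J"
    by (simp add: mult.commute)
  have "spectral_norm (D ** A) \<le> spectral_norm D * spectral_norm (E ** (mat 1 - Z))"
    unfolding DA by (rule spectral_norm_mult_le)
  also have "\<dots> \<le> 1 * spectral_norm (E ** (mat 1 - Z))"
    by (rule mult_right_mono) (simp_all add: D_def residual_projector_pinv spectral_norm_nonneg)
  also have "\<dots> \<le> spectral_norm E * spectral_norm (mat 1 - Z)"
    using spectral_norm_mult_le by simp
  also have "\<dots> \<le> e * (spectral_norm W * spectral_norm ?J)"
    using err Z e by (intro mult_mono spectral_norm_nonneg) (simp_all add: E_def)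
  finally show ?thesis
    by (simp add: D_def mult.commute)
qed

text \<open>
  Here \<open>I - Z\<close> stands on the left and removes \<open>V B\<close>, while \<open>Z A\<close> is a multiple of \<open>P\<^sup>T A\<close>, which the
  residual projector on the right annihilates.
\<close>
lemma row_projection_error:
  fixes A :: "real ^ 'n ^ 'm" and B :: "real ^ 'n ^ 'k" and V P :: "real ^ 'k ^ 'm"
  assumes inv: "invertible (transpose P ** V)"
    and err: "spectral_norm (A - V ** B) \<le> e"
    and P: "spectral_norm P \<le> 1"
  shows "spectral_norm (A ** (mat 1 - pinv (transpose P ** A) ** (transpose P ** A)))
           \<le> spectral_norm V * spectral_norm (matrix_inv (transpose P ** V)) * e"
proof -
  let ?J = "matrix_inv (transpose P ** V)"
  define Z where "Z = V ** ?J ** transpose P"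
  define E where "E = A - V ** B"
  define D where "D = mat 1 - pinv (transpose P ** A) ** (transpose P ** A)"
  note obl = oblique_projector[OF inv, folded Z_def]
  have "(mat 1 - Z) ** (V ** B) = 0"
    using obl(2) by (simp add: matrix_mul_assoc)
  then have E: "(mat 1 - Z) ** E = (mat 1 - Z) ** A"
    by (simp add: E_def matrix_mult_diff_left)
  have "(Z ** A) ** D = (V ** ?J) ** ((transpose P ** A) ** D)"
    by (simp add: Z_def matrix_mul_assoc)
  also have "\<dots> = 0"
    by (simp add: D_def residual_projector_pinv(2))
  finally have "A ** D = ((mat 1 - Z) ** A) ** D"
    by (simp add: matrix_mult_diff_right)
  then have AD: "A ** D = ((mat 1 - Z) ** E) ** D"
    by (simp only: E)
  have e: "0 \<le> e" using spectral_norm_nonneg err by (rule order_trans)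
  have "spectral_norm (mat 1 - Z) \<le> spectral_norm V * spectral_norm ?J * spectral_norm (transpose P)"
    by (rule obl(3))
  also have "\<dots> \<le> spectral_norm V * spectral_norm ?J * 1"
    using order_trans[OF spectral_norm_transpose_le P]
    by (intro mult_left_mono mult_nonneg_nonneg spectral_norm_nonneg)
  finally have Z: "spectral_norm (mat 1 - Z) \<le> spectral_norm V * spectral_norm ?J"
    by simp
  have "spectral_norm (A ** D) \<le> spectral_norm ((mat 1 - Z) ** E) * spectral_norm D"
    unfolding AD by (rule spectral_norm_mult_le)
  also have "\<dots> \<le> spectral_norm ((mat 1 - Z) ** E) * 1"
    by (rule mult_left_mono) (simp_all add: D_def residual_projector_pinv spectral_norm_nonneg)
  also have "\<dots> \<le> spectral_norm (mat 1 - Z) * spectral_norm E"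
    using spectral_norm_mult_le by simp
  also have "\<dots> \<le> spectral_norm V * spectral_norm ?J * e"
    using err Z by (intro mult_mono mult_nonneg_nonneg spectral_norm_nonneg) (simp_all add: E_def)
  finally show ?thesis
    by (simp add: D_def)
qed

theorem lemma3p2:
  fixes A :: "real ^ 'n ^ 'm"
    and V :: "real ^ 'k ^ 'm" and S :: "real ^ 'k ^ 'k" and W :: "real ^ 'k ^ 'n"
    and \<theta> \<phi> :: real
    and p :: "'k \<Rightarrow> 'm" and q :: "'k \<Rightarrow> 'n"
    and P :: "real ^ 'k ^ 'm" and Q :: "real ^ 'k ^ 'n"
    and C :: "real ^ 'k ^ 'm" and R :: "real ^ 'n ^ 'k"
    and \<eta>p \<eta>q :: real
  assumes "CARD('k) < min CARD('m) CARD('n)"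
    and "spectral_norm (A - V ** S ** transpose W)
           \<le> \<theta> * singular_value A (CARD('k) + 1) + \<phi>"
    and "P = identity_columns p" and "Q = identity_columns q"
    and "invertible (transpose P ** V)" and "invertible (transpose W ** Q)"
    and "\<eta>p = spectral_norm (matrix_inv (transpose P ** V))"
    and "\<eta>q = spectral_norm (matrix_inv (transpose W ** Q))"
    and "C = A ** Q" and "R = transpose P ** A"
  shows "spectral_norm ((mat 1 - C ** pinv C) ** A)
           \<le> spectral_norm W * \<eta>q * (\<theta> * singular_value A (CARD('k) + 1) + \<phi>)
       \<and> spectral_norm (A ** (mat 1 - pinv R ** R))
           \<le> spectral_norm V * \<eta>p * (\<theta> * singular_value A (CARD('k) + 1) + \<phi>)"
proof
  have "inj q"
    using assms(4,6) inj_if_invertible_identity_columns by blast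
  then have "spectral_norm Q \<le> 1"
    by (simp add: assms(4) spectral_norm_identity_columns_le_1)
  then show "spectral_norm ((mat 1 - C ** pinv C) ** A)
      \<le> spectral_norm W * \<eta>q * (\<theta> * singular_value A (CARD('k) + 1) + \<phi>)"
    unfolding assms(8,9) using column_projection_error assms(2,6) by blast
  \<comment> \<open>Transposition moves the selection matrix to the right, where it forces distinct indices.\<close>
  have "invertible (transpose V ** P)"
    using transpose_invertible[OF assms(5)] by (simp add: matrix_transpose_mul)
  then have "inj p"
    using assms(3) inj_if_invertible_identity_columns by blast
  then have "spectral_norm P \<le> 1"
    by (simp add: assms(3) spectral_norm_identity_columns_le_1)
  moreover have "spectral_norm (A - V ** (S ** transpose W))
      \<le> \<theta> * singular_value A (CARD('k) + 1) + \<phi>"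
    using assms(2) by (simp add: matrix_mul_assoc)
  ultimately show "spectral_norm (A ** (mat 1 - pinv R ** R))
      \<le> spectral_norm V * \<eta>p * (\<theta> * singular_value A (CARD('k) + 1) + \<phi>)"
    unfolding assms(7,10) using row_projection_error assms(5) by blast
qed

end
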